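(* Let $f:\mathbb{N}_0\to\mathbb{R}_+$ and suppose that: (i) there is $c_0\in\mathbb{N}_0\cup\{\infty\}$ such that $f$ is increasing up to $c_0$ and constant afterwards, i.e. $f(i-1)<f(i)$ for all integers $1\le i\le c_0$, and $f(i+1)=f(c_0)$ for all integers $i\ge c_0$ (if $c_0=\infty$, then $f$ is strictly increasing on all of $\mathbb{N}_0$); and (ii) there exists a real $\kappa\ge 1$ such that $$\sum_{i=1}^{c_0}\left(\frac{f\left(\lfloor i/\kappa\rfloor\right)}{f(i)}\right)^{i/\kappa} e^{f(i)}<\infty .$$ Then there exists a probability distribution $P_X$ supported on the set $\mathcal{W}=\{w_i : w_i=f(i-1),\ i\in\mathbb{N}\}$ such that, when $X\sim P_X$ and $Y$ given $X$ follows the Poisson noise model, for all $y\in\mathbb{N}_0$ $$\mathsf{med}(X\mid Y=y)=f(y).$$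
   Context: $\mathbb{N}=\{1,2,\dots\}$, $\mathbb{N}_0=\{0,1,2,\dots\}$, $\mathbb{R}_+=(0,\infty)$. A distribution is supported on $\mathcal{W}$ if it assigns probability one to $\mathcal{W}$. Poisson noise model: $X$ is a non-negative random variable with distribution (prior) $P_X$, and $Y$ is an $\mathbb{N}_0$-valued random variable with conditional law $P_{Y|X}(y|x)=\frac{1}{y!}x^y e^{-x}$ for $x\ge 0$, $y\in\mathbb{N}_0$, with the convention $0^0=1$. Conditional median: $\mathsf{med}(X\mid Y=y)=F^{-1}_{X|Y=y}(1/2)$, where $F^{-1}_{X|Y=y}$ is the left-inverse (quantile function) of the conditional cdf, i.e. $\mathsf{med}(X\mid Y=y)=\inf\{t: P[X\le t\mid Y=y]\ge 1/2\}$. *)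

theory Defs
  imports "HOL-Probability.Probability"
begin

definition supported_on :: "real measure \<Rightarrow> real set \<Rightarrow> bool" where
  "supported_on P W \<longleftrightarrow> W \<in> sets P \<and> measure P W = 1"

(* Only meaningful for x >= 0.  Unlike the library's poisson_pmf it also covers x = 0,
   where 0 ^ 0 = 1 makes it the point mass at 0. *)
definition poisson_kernel :: "real \<Rightarrow> nat \<Rightarrow> real" where
  "poisson_kernel x y = 1 / fact y * x ^ y * exp (- x)"

(* The joint law of (X, Y) when X has law P on the non-negative reals and Y given X = x has
   mass function poisson_kernel x; X is the coordinate fst and Y the coordinate snd.
   The lemmas below justify this. *)
definition poisson_joint :: "real measure \<Rightarrow> (real \<times> nat) measure" where
  "poisson_joint P =
     density (P \<Otimes>\<^sub>M count_space UNIV) (\<lambda>(x, y). ennreal (poisson_kernel x y))"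

(* The left-inverse of the conditional cdf at 1/2.  The elementary conditional probability
   is meaningful when Y = y has positive probability. *)
definition cond_median ::
    "'a measure \<Rightarrow> ('a \<Rightarrow> real) \<Rightarrow> ('a \<Rightarrow> nat) \<Rightarrow> nat \<Rightarrow> real" where
  "cond_median M X Y y = Inf {t. \<P>(\<omega> in M. X \<omega> \<le> t \<bar> Y \<omega> = y) \<ge> 1 / 2}"

lemma poisson_kernel_nonneg: "0 \<le> x \<Longrightarrow> 0 \<le> poisson_kernel x y"
  by (simp add: poisson_kernel_def)

lemma poisson_kernel_sums: "poisson_kernel x sums 1"
proof -
  have "(\<lambda>y. x ^ y /\<^sub>R fact y * exp (- x)) sums (exp x * exp (- x))"
    by (intro sums_mult2 exp_converges)
  then show ?thesis
    by (simp add: poisson_kernel_def [abs_def] exp_minus divide_inverse)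
qed

lemma measurable_poisson_kernel [measurable]:
  assumes [measurable_cong, simp]: "sets P = sets borel"
  shows "(\<lambda>(x, y). ennreal (poisson_kernel x y)) \<in> borel_measurable (P \<Otimes>\<^sub>M count_space UNIV)"
  unfolding poisson_kernel_def by measurable

lemma sets_poisson_joint:
  "sets P = sets borel \<Longrightarrow> sets (poisson_joint P) = sets (borel \<Otimes>\<^sub>M count_space UNIV)"
  unfolding poisson_joint_def sets_density by (intro sets_pair_measure_cong) auto

lemma emeasure_poisson_joint:
  assumes P: "sigma_finite_measure P" "sets P = sets borel" and A: "A \<in> sets borel"
  shows "emeasure (poisson_joint P) (A \<times> B) =
    (\<integral>\<^sup>+x. indicator A x * (\<Sum>y. ennreal (poisson_kernel x y) * indicator B y) \<partial>P)"
proof -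
  interpret C: sigma_finite_measure "count_space (UNIV :: nat set)"
    by (rule sigma_finite_measure_count_space)
  note [measurable_cong] = P(2)
  note [measurable] = A measurable_poisson_kernel [OF P(2)]
  have "emeasure (poisson_joint P) (A \<times> B) =
      (\<integral>\<^sup>+z. (case z of (x, y) \<Rightarrow> ennreal (poisson_kernel x y)) * indicator (A \<times> B) z
         \<partial>(P \<Otimes>\<^sub>M count_space UNIV))"
    unfolding poisson_joint_def by (intro emeasure_density) (simp_all add: P(2) A)
  also have "\<dots> = (\<integral>\<^sup>+x. \<integral>\<^sup>+y. ennreal (poisson_kernel x y) * indicator (A \<times> B) (x, y)
       \<partial>count_space UNIV \<partial>P)"
    by (subst C.nn_integral_fst [symmetric]) (simp_all add: P(2) A)
  also have "\<dots> = (\<integral>\<^sup>+x. indicator A x * (\<Sum>y. ennreal (poisson_kernel x y) * indicator B y) \<partial>P)"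
    by (intro nn_integral_cong)
       (auto simp: nn_integral_count_space_nat indicator_times split: split_indicator)
  finally show ?thesis .
qed

lemma emeasure_poisson_joint_fst:
  assumes P: "prob_space P" "sets P = sets borel" "AE x in P. 0 \<le> x" and A: "A \<in> sets borel"
  shows "emeasure (poisson_joint P) (A \<times> UNIV) = emeasure P A"
proof -
  have "emeasure (poisson_joint P) (A \<times> UNIV) =
      (\<integral>\<^sup>+x. indicator A x * (\<Sum>y. ennreal (poisson_kernel x y)) \<partial>P)"
    using emeasure_poisson_joint [of P A UNIV] P A
    by (simp add: prob_space_imp_sigma_finite)
  also have "\<dots> = (\<integral>\<^sup>+x. indicator A x \<partial>P)"
    using P(3)
  proof (intro nn_integral_cong_AE, eventually_elim)
    case (elim x)
    have "(\<Sum>y. ennreal (poisson_kernel x y)) = ennreal 1"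
      using poisson_kernel_sums [of x] elim
      by (simp add: suminf_ennreal2 poisson_kernel_nonneg sums_iff)
    then show ?case by simp
  qed
  finally show ?thesis using A P(2) by simp
qed

lemma prob_space_poisson_joint:
  assumes "prob_space P" "sets P = sets borel" "AE x in P. 0 \<le> x"
  shows "prob_space (poisson_joint P)"
proof
  have "space P = UNIV" using sets_eq_imp_space_eq [OF assms(2)] by simp
  then show "emeasure (poisson_joint P) (space (poisson_joint P)) = 1"
    using emeasure_poisson_joint_fst [OF assms, of UNIV] prob_space.emeasure_space_1 [OF assms(1)]
    by (simp add: poisson_joint_def space_pair_measure)
qed

lemma distr_poisson_joint_fst:
  assumes "prob_space P" "sets P = sets borel" "AE x in P. 0 \<le> x"
  shows "distr (poisson_joint P) borel fst = P"
proof (rule measure_eqI)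
  fix A :: "real set" assume "A \<in> sets (distr (poisson_joint P) borel fst)"
  then have A: "A \<in> sets borel" by simp
  have m: "fst \<in> borel_measurable (poisson_joint P)"
    unfolding measurable_cong_sets [OF sets_poisson_joint [OF assms(2)] refl] by measurable
  have "space (poisson_joint P) = UNIV"
    using sets_eq_imp_space_eq [OF sets_poisson_joint [OF assms(2)]]
    by (simp add: space_pair_measure)
  then have "fst -` A \<inter> space (poisson_joint P) = A \<times> UNIV" by auto
  then show "emeasure (distr (poisson_joint P) borel fst) A = emeasure P A"
    using emeasure_poisson_joint_fst [OF assms A] by (simp add: emeasure_distr [OF m A])
qed (simp add: assms)

lemma emeasure_poisson_joint_snd:
  assumes "prob_space P" "sets P = sets borel" "A \<in> sets borel"
  shows "emeasure (poisson_joint P) (A \<times> {y}) =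
    (\<integral>\<^sup>+x. ennreal (poisson_kernel x y) * indicator A x \<partial>P)"
proof -
  have "(\<Sum>k. ennreal (poisson_kernel x k) * indicator {y} k) = ennreal (poisson_kernel x y)"
    for x :: real
    by (subst suminf_finite [of "{y}"]) auto
  then show ?thesis
    using emeasure_poisson_joint [of P A "{y}"] assms
    by (simp add: prob_space_imp_sigma_finite mult.commute)
qed

end

theory Submission
  imports Defs "HOL-Complex_Analysis.Great_Picard"
begin

text \<open>
  Let $q_i$ be proportional to $P_X(f(i)) e^{-f(i)}$.  Given $Y = y$, the atom $f(i)$ has weight
  proportional to $q_i f(i)^y$.  If, at a real exponent $s_y \in [y, y+1)$, the atoms up to
  $f(y)$ and those above $f(y)$ have equal total weight $\sum q_i f(i)^{s_y}$, then lowering the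
  exponent favours the lower group and raising it favours the upper group.  Hence balance at
  every cut $y < c_0$ makes $f(y)$ the conditional median for every $y$.

  For finitely many atoms such balanced weights exist.  For infinitely many, they are obtained as
  a limit of finite ones.  Balance at the cut $y = \lfloor i/\kappa \rfloor$ gives
  $q_i \le (f(y)/f(i))^{s_y} \le (f(y)/f(i))^{i/\kappa}$ when $s_y \ge i/\kappa$, and the
  summability hypothesis makes this bound a dominating sequence, so that no mass escapes and
  $\sum q_i e^{f(i)}$ is finite.
\<close>

section \<open>Comparison of the two sides of a cut under a change of exponent\<close>

text \<open>This sign turns the weight up to \<open>y\<close> minus the weight above
  \<open>y\<close> into a single series; balance at the cut \<open>y\<close> means that the series
  has sum 0.\<close>

definition cut_sign :: "nat \<Rightarrow> nat \<Rightarrow> real" where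
  "cut_sign y i = (if i \<le> y then 1 else - 1)"

lemma cut_sign_Suc_Suc [simp]: "cut_sign (Suc y) (Suc i) = cut_sign y i"
  by (simp add: cut_sign_def)

lemma abs_cut_sign [simp]: "\<bar>cut_sign y i\<bar> = 1"
  by (simp add: cut_sign_def)

text \<open>Split off the factor \<open>x i powr (t - s)\<close>. It is at most
  \<open>x y powr (t - s)\<close> up to the cut and at least that above it; the sign reverses the
  second estimate, so one termwise inequality serves both sides.\<close>

lemma cut_sign_powr_le:
  fixes x :: "nat \<Rightarrow> real"
  assumes "\<And>i. 0 < x i" "mono x" "s \<le> t"
  shows "cut_sign y i * x i powr t \<le> x y powr (t - s) * (cut_sign y i * x i powr s)"
proof -
  have split: "x i powr t = x i powr (t - s) * x i powr s"
    by (simp flip: powr_add)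
  show ?thesis
  proof (cases "i \<le> y")
    case True
    then have "x i powr (t - s) \<le> x y powr (t - s)"
      using assms by (intro powr_mono2) (auto simp: less_imp_le monoD)
    with True show ?thesis
      unfolding split by (simp add: cut_sign_def mult_right_mono)
  next
    case False
    then have "x y powr (t - s) \<le> x i powr (t - s)"
      using assms by (intro powr_mono2) (auto simp: less_imp_le monoD)
    with False show ?thesis
      unfolding split by (simp add: cut_sign_def mult_right_mono)
  qed
qed

lemma summable_cut_sign:
  fixes g :: "nat \<Rightarrow> real"
  assumes "summable g" "\<And>i. 0 \<le> g i"
  shows "summable (\<lambda>i. cut_sign y i * g i)"
  using assms(1) by (rule summable_comparison_test') (simp add: abs_mult assms(2))

text \<open>Lowering the exponent favours the lower group: by the termwise comparison, the balanced
  series at \<open>s\<close> is at most a positive multiple of the series at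
  \<open>t\<close>.\<close>

lemma cut_sum_nonneg:
  fixes x q :: "nat \<Rightarrow> real"
  assumes x: "\<And>i. 0 < x i" "mono x" and q: "\<And>i. 0 \<le> q i"
    and t: "summable (\<lambda>i. q i * x i powr t)" "t \<le> s"
    and bal: "(\<lambda>i. cut_sign y i * (q i * x i powr s)) sums 0"
  shows "0 \<le> (\<Sum>i. cut_sign y i * (q i * x i powr t))"
proof -
  let ?c = "x y powr (s - t)"
  have sm: "summable (\<lambda>i. cut_sign y i * (q i * x i powr t))"
    using t(1) q by (intro summable_cut_sign) auto
  have "0 \<le> ?c * (\<Sum>i. cut_sign y i * (q i * x i powr t))"
  proof (rule sums_le [OF _ bal sums_mult [OF summable_sums [OF sm]]])
    fix i
    show "cut_sign y i * (q i * x i powr s) \<le> ?c * (cut_sign y i * (q i * x i powr t))"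
      using mult_left_mono [OF cut_sign_powr_le [OF x t(2)] q [of i], of y i]
      by (simp add: mult_ac)
  qed
  then show ?thesis
    using x(1) [of y] by (simp add: zero_le_mult_iff less_imp_le)
qed

text \<open>The same comparison gives a sum of at most 0. Equality would force equality in every
  term; the gap between \<open>x y\<close> and \<open>x (Suc y)\<close> then removes all weight
  above the cut, and balance removes the rest, against \<open>q k \<noteq> 0\<close>.\<close>

lemma cut_sum_neg:
  fixes x q :: "nat \<Rightarrow> real"
  assumes x: "\<And>i. 0 < x i" "mono x" "x y < x (Suc y)" and q: "\<And>i. 0 \<le> q i" "q k \<noteq> 0"
    and t: "summable (\<lambda>i. q i * x i powr t)" "s < t"
    and bal: "(\<lambda>i. cut_sign y i * (q i * x i powr s)) sums 0"
  shows "(\<Sum>i. cut_sign y i * (q i * x i powr t)) < 0"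
proof (rule ccontr)
  let ?c = "x y powr (t - s)"
  let ?a = "\<lambda>i. cut_sign y i * (q i * x i powr t)"
  let ?b = "\<lambda>i. ?c * (cut_sign y i * (q i * x i powr s))"
  assume "\<not> (\<Sum>i. ?a i) < 0"
  have sm: "summable ?a"
    using t(1) q by (intro summable_cut_sign) auto
  have b: "?b sums 0"
    using sums_mult [OF bal] by simp
  have le: "?a i \<le> ?b i" for i
    using mult_left_mono [OF cut_sign_powr_le [OF x(1,2) less_imp_le [OF t(2)]] q(1) [of i], of y i]
    by (simp add: mult_ac)
  have d: "(\<lambda>i. ?b i - ?a i) sums (0 - suminf ?a)"
    by (intro sums_diff b summable_sums sm)
  have "0 \<le> 0 - suminf ?a"
    by (rule sums_le [OF _ sums_zero d]) (use le in simp)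
  with \<open>\<not> suminf ?a < 0\<close> have "suminf ?a = 0"
    by simp
  with d have "(\<lambda>i. ?b i - ?a i) sums 0"
    by simp
  then have eq: "?b i = ?a i" for i
    using suminf_eq_zero_iff [of "\<lambda>i. ?b i - ?a i"] le by (auto simp: sums_iff)
  have above: "q i = 0" if "y < i" for i
  proof (rule ccontr)
    assume "q i \<noteq> 0"
    have "x y < x i"
      using x(3) monoD [OF x(2), of "Suc y" i] that by simp
    then have "?c < x i powr (t - s)"
      using t(2) x(1) [of y] by (intro powr_less_mono2) auto
    then have "?c * x i powr s < x i powr (t - s) * x i powr s"
      using x(1) [of i] by (intro mult_strict_right_mono) auto
    also have "\<dots> = x i powr t"
      by (simp flip: powr_add)
    finally show False
      using eq [of i] that \<open>q i \<noteq> 0\<close> by (simp add: cut_sign_def)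
  qed
  \<comment> \<open>With no weight above the cut, the balanced series has nonnegative terms and sum
    0, so each term vanishes.\<close>
  have nn: "0 \<le> cut_sign y i * (q i * x i powr s)" for i
    using above [of i] q by (cases "i \<le> y") (auto simp: cut_sign_def)
  have "cut_sign y k * (q k * x k powr s) = 0"
    using suminf_eq_zero_iff [of "\<lambda>i. cut_sign y i * (q i * x i powr s)"] nn bal
    by (auto simp: sums_iff)
  then show False
    using q(2) x(1) [of k] by (simp add: cut_sign_def split: if_splits)
qed

section \<open>Balanced weights on finitely many points\<close>

text \<open>\<open>F\<close> is \<open>G\<close> with a zero inserted at index 1; this carries
  series for the points without point 1 back to the full indexing.\<close>

lemma sums_skip_one:
  fixes G :: "nat \<Rightarrow> real"
  assumes "G sums l" "F 0 = G 0" "F 1 = 0" "\<And>i. F (Suc (Suc i)) = G (Suc i)"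
  shows "F sums l"
proof -
  have "(\<lambda>i. F (Suc (Suc i))) sums (l - G 0)"
    using assms(1,4) sums_Suc_iff [of G] by simp
  then have "(\<lambda>i. F (Suc i)) sums (l - G 0)"
    using sums_Suc [of "\<lambda>i. F (Suc i)"] assms(3) by fastforce
  then show ?thesis
    using sums_Suc [of F] assms(2) by fastforce
qed

text \<open>Induction on the number of points.  Dropping the point 0 and dropping the point 1 both give
  weights that are balanced at all cuts but the first, with opposite signs at the first cut,
  so that some convex combination of them is balanced there as well.\<close>
lemma finite_balanced_weights:
  fixes x s :: "nat \<Rightarrow> real"
  assumes "\<And>i. 0 < x i" "mono x" "mono s"
  shows "\<exists>q. (\<forall>i. 0 \<le> q i) \<and> (\<forall>i>n. q i = 0) \<and> q sums 1 \<and>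
    (\<forall>y<n. (\<lambda>i. cut_sign y i * (q i * x i powr s y)) sums 0)"
  using assms
proof (induction n arbitrary: x s)
  case 0
  have "(\<lambda>i. if i = 0 then 1 else 0 :: real) sums 1"
    by (rule sums_single)
  then show ?case
    by (intro exI [of _ "\<lambda>i. if i = 0 then 1 else 0"]) auto
next
  case (Suc n)
  note x = Suc.prems(1,2) and s = Suc.prems(3)
  \<comment> \<open>After dropping point 0 or point 1, cut \<open>y\<close> of the remaining points
    is cut \<open>Suc y\<close> of the original ones, so both reduced problems take the shifted
    exponents.\<close>
  let ?s = "\<lambda>i. s (Suc i)"
  let ?x = "\<lambda>i. if i = 0 then x 0 else x (Suc i)"
  have mono: "mono ?s" "mono (\<lambda>i. x (Suc i))" "mono ?x"
    using s x(2) by (auto simp: mono_def)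
  have pos': "0 < ?x i" for i
    using x(1) by simp
  obtain u' where u': "\<And>i. 0 \<le> u' i" "\<And>i. n < i \<Longrightarrow> u' i = 0" "u' sums 1"
    "\<And>y. y < n \<Longrightarrow> (\<lambda>i. cut_sign y i * (u' i * x (Suc i) powr ?s y)) sums 0"
    using Suc.IH [OF x(1) mono(2,1)] by auto
  obtain v' where v': "\<And>i. 0 \<le> v' i" "\<And>i. n < i \<Longrightarrow> v' i = 0" "v' sums 1"
    "\<And>y. y < n \<Longrightarrow> (\<lambda>i. cut_sign y i * (v' i * ?x i powr ?s y)) sums 0"
    using Suc.IH [OF pos' mono(3,1)] by blast
  define u where "u i = (case i of 0 \<Rightarrow> 0 | Suc j \<Rightarrow> u' j)" for i
  define v where "v i = (case i of 0 \<Rightarrow> v' 0 | Suc 0 \<Rightarrow> 0 | Suc (Suc j) \<Rightarrow> v' (Suc j))" for i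
  have u_simps [simp]: "u 0 = 0" "\<And>j. u (Suc j) = u' j"
    by (simp_all add: u_def)
  have v_simps [simp]: "v 0 = v' 0" "v (Suc 0) = 0" "\<And>j. v (Suc (Suc j)) = v' (Suc j)"
    by (simp_all add: v_def)
  have u: "0 \<le> u i" "Suc n < i \<Longrightarrow> u i = 0" for i
    by (cases i; simp add: u')+
  have v: "0 \<le> v i" "Suc n < i \<Longrightarrow> v i = 0" for i
    using v' by (auto simp: v_def split: nat.split)
  have u1: "u sums 1"
    using sums_Suc [of u 1] u'(3) by simp
  have v1: "v sums 1"
    by (rule sums_skip_one [OF v'(3)]) auto
  have ucut: "(\<lambda>i. cut_sign (Suc y) i * (u i * x i powr s (Suc y))) sums 0" if "y < n" for y
    using sums_Suc [of "\<lambda>i. cut_sign (Suc y) i * (u i * x i powr s (Suc y))" 0] u'(4) [OF that]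
    by simp
  have vcut: "(\<lambda>i. cut_sign (Suc y) i * (v i * x i powr s (Suc y))) sums 0" if "y < n" for y
    by (rule sums_skip_one [OF v'(4) [OF that]]) (auto simp: cut_sign_def)
  let ?g = "\<lambda>w i. cut_sign 0 i * (w i * x i powr s 0)"
  have sm: "summable (?g w)" if "\<And>i. Suc n < i \<Longrightarrow> w i = 0" for w
    using that by (intro summable_finite [of "{..Suc n}"]) auto
  \<comment> \<open>\<open>u\<close> puts nothing on point 0, so at the first cut all of its weight
    lies above.\<close>
  have gu: "suminf (?g u) < 0"
  proof -
    obtain k where k: "u' k \<noteq> 0"
      using u'(3) by (metis sums_0 sums_unique2 zero_neq_one)
    have "0 < suminf (\<lambda>i. - ?g u i)"
    proof (rule suminf_pos2)
      show "summable (\<lambda>i. - ?g u i)"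
        using sm [of u] u(2) by (auto simp: summable_minus_iff)
      show "0 \<le> - ?g u i" for i
        using u'(1) by (cases i) (auto simp: cut_sign_def)
      show "0 < - ?g u (Suc k)"
        using k u'(1) [of k] x(1) [of "Suc k"] by (simp add: cut_sign_def less_le)
    qed
    then show ?thesis
      using suminf_minus [OF sm [of u]] u(2) by simp
  qed
  \<comment> \<open>The first cut also separates point 0 from the rest in the problem without point
    1. There \<open>v'\<close> is balanced at exponent \<open>s 1\<close>, and passing down to
    \<open>s 0\<close> favours point 0. For \<open>n = 0\<close> there is no such cut, but all
    weight is on point 0.\<close>
  have gv: "0 \<le> suminf (?g v)"
  proof -
    let ?G = "\<lambda>i. cut_sign 0 i * (v' i * ?x i powr s 0)"
    have smG: "summable (\<lambda>i. v' i * ?x i powr s 0)"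
      using v'(2) by (intro summable_finite [of "{..n}"]) auto
    have "0 \<le> suminf ?G"
    proof (cases "n = 0")
      case True
      then have "0 \<le> ?G i" for i
        using v'(1,2) [of i] by (cases i) (auto simp: cut_sign_def)
      moreover have "summable ?G"
        using smG v' by (intro summable_cut_sign) auto
      ultimately show ?thesis
        by (intro suminf_nonneg)
    next
      case False
      show ?thesis
        by (rule cut_sum_nonneg [where s = "s (Suc 0)", OF pos' mono(3) v'(1) smG])
           (use v'(4) [of 0] False s in \<open>auto simp: monoD\<close>)
    qed
    moreover have "?g v sums suminf ?G"
      by (rule sums_skip_one [where G = ?G])
        (use summable_cut_sign [OF smG, of 0] v'(1) in \<open>auto simp: cut_sign_def intro: summable_sums\<close>)
    ultimately show ?thesis
      by (simp add: sums_iff)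
  qed
  \<comment> \<open>\<open>a\<close> and \<open>b\<close> are the convex coefficients that cancel
    the negative sum of \<open>u\<close> against the nonnegative sum of \<open>v\<close> at the
    first cut.\<close>
  define d where "d = suminf (?g v) - suminf (?g u)"
  define a where "a = suminf (?g v) / d"
  define b where "b = - suminf (?g u) / d"
  have d: "0 < d"
    using gu gv by (simp add: d_def)
  have ab: "0 \<le> a" "0 \<le> b" "a + b = 1" "a * suminf (?g u) + b * suminf (?g v) = 0"
  proof -
    show "0 \<le> a" "0 \<le> b"
      using d gu gv by (simp_all add: a_def b_def divide_nonpos_pos)
    have "a + b = (suminf (?g v) - suminf (?g u)) / d"
      by (simp add: a_def b_def diff_divide_distrib)
    then show "a + b = 1"
      using d by (simp flip: d_def)
    show "a * suminf (?g u) + b * suminf (?g v) = 0"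
      by (simp add: a_def b_def mult.commute)
  qed
  define q where "q i = a * u i + b * v i" for i
  have lin: "(\<lambda>i. cut_sign y i * (q i * x i powr s y)) sums (a * l + b * m)"
    if "(\<lambda>i. cut_sign y i * (u i * x i powr s y)) sums l"
       "(\<lambda>i. cut_sign y i * (v i * x i powr s y)) sums m" for y l m
    using sums_add [OF sums_mult [OF that(1), of a] sums_mult [OF that(2), of b]]
    by (simp add: q_def algebra_simps)
  have "(\<lambda>i. cut_sign y i * (q i * x i powr s y)) sums 0" if "y < Suc n" for y
  proof (cases y)
    case 0
    then show ?thesis
      using lin [OF summable_sums [OF sm [OF u(2)]] summable_sums [OF sm [OF v(2)]]] ab(4)
      by simp
  next
    case (Suc y')
    then show ?thesis
      using lin [OF ucut vcut] that by simp
  qed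
  moreover have "q sums 1"
    using sums_add [OF sums_mult [OF u1, of a] sums_mult [OF v1, of b]] ab by (simp add: q_def [abs_def])
  moreover have "0 \<le> q i" "Suc n < i \<Longrightarrow> q i = 0" for i
    using u v ab by (simp_all add: q_def)
  ultimately show ?case
    by blast
qed

section \<open>Balanced weights on infinitely many points\<close>

text \<open>By balance the lower group is half of the total, so one term above the cut is at most
  the whole lower group, which is at most \<open>x y powr s\<close> because the \<open>q j\<close>
  have total 1.\<close>

lemma balanced_weight_bound:
  fixes x q :: "nat \<Rightarrow> real"
  assumes x: "\<And>i. 0 < x i" "mono x" and q: "\<And>i. 0 \<le> q i" "q sums 1"
    and s: "0 \<le> s" and sm: "summable (\<lambda>i. q i * x i powr s)"
    and bal: "(\<lambda>i. cut_sign y i * (q i * x i powr s)) sums 0" and "y < i"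
  shows "q i \<le> (x y / x i) powr s"
proof -
  let ?w = "\<lambda>i. q i * x i powr s"
  have w0: "0 \<le> ?w j" for j
    using q by simp
  have "(\<lambda>j. if j \<in> {..y} then ?w j else 0) sums (\<Sum>j\<le>y. ?w j)"
    by (rule sums_If_finite_set) simp
  \<comment> \<open>Twice the indicator of \<open>{..y}\<close> minus \<open>cut_sign y\<close> is
    identically 1.\<close>
  from sums_diff [OF sums_mult [OF this, of 2] bal]
  have tot: "?w sums (2 * (\<Sum>j\<le>y. ?w j))"
    by (simp add: cut_sign_def if_distrib cong: if_cong)
       (smt (verit, best) sums_cong)
  have "(\<Sum>j\<in>insert i {..y}. ?w j) \<le> suminf ?w"
    using sm w0 by (intro sum_le_suminf) auto
  also have "suminf ?w = 2 * (\<Sum>j\<le>y. ?w j)"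
    using tot by (simp add: sums_iff)
  finally have "?w i \<le> (\<Sum>j\<le>y. ?w j)"
    using \<open>y < i\<close> by simp
  also have "\<dots> \<le> (\<Sum>j\<le>y. q j * x y powr s)"
    using x q s by (intro sum_mono mult_left_mono powr_mono2) (auto simp: less_imp_le monoD)
  also have "\<dots> = (\<Sum>j\<le>y. q j) * x y powr s"
    by (simp add: sum_distrib_right)
  also have "(\<Sum>j\<le>y. q j) \<le> 1"
    using sum_le_suminf [of q "{..y}"] q by (simp add: sums_iff)
  finally have "?w i \<le> x y powr s"
    by (simp add: mult_right_mono)
  then show ?thesis
    using x(1) [of i] x(1) [of y] by (simp add: powr_divide field_simps)
qed

text \<open>A coordinatewise limit of finite balanced weights. The majorant \<open>h\<close> bounds
  all of them at once, so total mass and every balance equation survive the limit.\<close>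

lemma infinite_balanced_weights:
  fixes x s h :: "nat \<Rightarrow> real"
  assumes x: "\<And>i. 0 < x i" "mono x" and s: "mono s" "\<And>y. 0 \<le> s y"
    and h0: "1 \<le> h 0" and h: "\<And>i. 0 < i \<Longrightarrow> \<exists>y<i. (x y / x i) powr s y \<le> h i"
    and h_sm: "summable h" "\<And>y. summable (\<lambda>i. h i * x i powr s y)"
  shows "\<exists>q. (\<forall>i. 0 \<le> q i \<and> q i \<le> h i) \<and> q sums 1 \<and>
    (\<forall>y. (\<lambda>i. cut_sign y i * (q i * x i powr s y)) sums 0)"
proof -
  obtain Q where Q: "\<And>n i. 0 \<le> Q n i" "\<And>n i. n < i \<Longrightarrow> Q n i = 0" "\<And>n. Q n sums 1"
    "\<And>n y. y < n \<Longrightarrow> (\<lambda>i. cut_sign y i * (Q n i * x i powr s y)) sums 0"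
    using finite_balanced_weights [OF x s(1)] by metis
  have Q1: "Q n i \<le> 1" for n i
    using sum_le_suminf [of "Q n" "{i}"] Q(1,3) by (simp add: sums_iff)
  have h_nonneg: "0 \<le> h i" for i
  proof (cases "i = 0")
    case False
    then show ?thesis
      using h [of i] powr_ge_zero order_trans by (metis neq0_conv)
  qed (use h0 in simp)
  have Qh: "Q n i \<le> h i" for n i
  \<comment> \<open>Index 0 has no cut below it and is bounded by the total mass, whence
    \<open>1 \<le> h 0\<close>. For \<open>0 < i \<le> n\<close> the cut \<open>y < i\<close> is one
    at which \<open>Q n\<close> is balanced.\<close>
  proof (cases "i = 0 \<or> n < i")
    case True
    then show ?thesis
      using Q1 [of n i] Q(2) [of n i] h0 h_nonneg [of i] by auto
  next
    case False
    then obtain y where y: "y < i" "(x y / x i) powr s y \<le> h i"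
      using h [of i] by auto
    have "summable (\<lambda>i. Q n i * x i powr s y)"
      using Q(2) by (intro summable_finite [of "{..n}"]) auto
    then have "Q n i \<le> (x y / x i) powr s y"
      using False y(1) by (intro balanced_weight_bound x Q s) auto
    with y(2) show ?thesis
      by simp
  qed
  obtain r where r: "strict_mono r" "\<And>i. i \<in> UNIV \<Longrightarrow> \<exists>l. (\<lambda>n. Q (r n) i) \<longlonglongrightarrow> l"
    by (rule function_convergent_subsequence [of UNIV Q 1]) (auto simp: Q Q1)
  then obtain q where q: "\<And>i. (\<lambda>n. Q (r n) i) \<longlonglongrightarrow> q i"
    by (metis UNIV_I)
  have q0: "0 \<le> q i" "q i \<le> h i" for i
    using q [of i] Q Qh by (auto intro: LIMSEQ_le_const LIMSEQ_le_const2)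
  \<comment> \<open>Tannery's theorem with majorant \<open>C i * h i\<close>. The identity is asked
    only for large \<open>n\<close>, since \<open>Q n\<close> is balanced at \<open>y\<close> only
    when \<open>y < n\<close>.\<close>
  have limit: "(\<lambda>i. c i * q i) sums L"
    if c: "\<And>i. \<bar>c i\<bar> \<le> C i" "summable (\<lambda>i. C i * h i)"
      and ev: "eventually (\<lambda>n. (\<lambda>i. c i * Q n i) sums L) sequentially" for c C L
  proof -
    have bound: "\<bar>c i * Q n i\<bar> \<le> C i * h i" for i n
      unfolding abs_mult using c(1) Q(1) Qh by (intro mult_mono) (auto intro: order_trans [OF abs_ge_zero])
    have t: "summable (\<lambda>i. norm (c i * q i)) \<and>
        (\<lambda>n. \<Sum>i. c i * Q (r n) i) \<longlonglongrightarrow> (\<Sum>i. c i * q i)"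
    proof (rule conjunct2 [OF tannerys_theorem [where M = "\<lambda>i. C i * h i"]])
      show "(\<lambda>n. c i * Q (r n) i) \<longlonglongrightarrow> c i * q i" for i
        by (intro tendsto_intros q)
      show "eventually (\<lambda>(i, n). norm (c i * Q (r n) i) \<le> C i * h i) (sequentially \<times>\<^sub>F sequentially)"
        using bound by (intro always_eventually) auto
    qed (use c(2) in auto)
    have "eventually (\<lambda>n. (\<lambda>i. c i * Q (r n) i) sums L) sequentially"
      using ev filterlim_subseq [OF r(1)] by (rule eventually_compose_filterlim)
    then have "eventually (\<lambda>n. (\<Sum>i. c i * Q (r n) i) = L) sequentially"
      by eventually_elim (simp add: sums_iff)
    then have "(\<lambda>n. \<Sum>i. c i * Q (r n) i) \<longlonglongrightarrow> L"
      by (rule tendsto_eventually)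
    with t have "(\<Sum>i. c i * q i) = L"
      by (meson LIMSEQ_unique)
    with t show ?thesis
      by (auto simp: sums_iff intro: summable_norm_cancel)
  qed
  have "q sums 1"
    using limit [of "\<lambda>_. 1" "\<lambda>_. 1" 1] h_sm(1) Q(3) by simp
  moreover have "(\<lambda>i. cut_sign y i * (q i * x i powr s y)) sums 0" for y
  proof -
    have "eventually (\<lambda>n. (\<lambda>i. cut_sign y i * x i powr s y * Q n i) sums 0) sequentially"
      using eventually_gt_at_top [of y]
      by eventually_elim (use Q(4) [of y] in \<open>simp add: mult_ac\<close>)
    from limit [OF _ _ this, of "\<lambda>i. x i powr s y"] show ?thesis
      using h_sm(2) [of y] by (simp add: mult_ac abs_mult)
  qed
  ultimately show ?thesis
    using q0 by blast
qed

section \<open>Conditional law and median under a discrete prior\<close>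

text \<open>Bayes' formula: the factor \<open>exp (f i)\<close> of the prior cancels
  \<open>exp (- f i)\<close> of the Poisson kernel, and \<open>Z\<close> and \<open>fact y\<close>
  cancel in the quotient.\<close>

lemma cond_prob_poisson_joint:
  fixes f q :: "nat \<Rightarrow> real" and p :: "nat pmf"
  assumes f: "\<And>i. 0 < f i" and q: "\<And>i. 0 \<le> q i" and Z: "0 < Z"
    and p: "\<And>i. pmf p i = q i * exp (f i) / Z"
    and sm: "summable (\<lambda>i. q i * f i ^ y)"
  shows "\<P>(\<omega> in poisson_joint (distr (measure_pmf p) borel f). fst \<omega> \<le> t \<bar> snd \<omega> = y) =
    (\<Sum>i. q i * f i ^ y * indicator {..t} (f i)) / (\<Sum>i. q i * f i ^ y)"
proof -
  let ?P = "distr (measure_pmf p) borel f"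
  let ?J = "poisson_joint ?P"
  let ?c = "1 / (Z * fact y)"
  have P: "prob_space ?P" "sets ?P = sets borel"
    by (auto intro: measure_pmf.prob_space_distr)
  have space: "space ?J = UNIV"
    using sets_eq_imp_space_eq [OF sets_poisson_joint [OF P(2)]] by (simp add: space_pair_measure)
  have J: "measure ?J (A \<times> {y}) = ?c * (\<Sum>i. q i * f i ^ y * indicator A (f i))"
    if A [measurable]: "A \<in> sets borel" for A
  proof -
    let ?g = "\<lambda>i. ?c * (q i * f i ^ y * indicator A (f i))"
    have sm': "summable (\<lambda>i. q i * f i ^ y * indicator A (f i))"
      using sm by (rule summable_comparison_test')
        (use q f in \<open>auto simp: less_imp_le split: split_indicator\<close>)
    have nn: "0 \<le> ?g i" for i
      using q [of i] f [of i] Z by simp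
    have "emeasure ?J (A \<times> {y}) = (\<integral>\<^sup>+x. ennreal (poisson_kernel x y) * indicator A x \<partial>?P)"
      by (rule emeasure_poisson_joint_snd [OF P A])
    also have "\<dots> = (\<integral>\<^sup>+i. ennreal (poisson_kernel (f i) y) * indicator A (f i) \<partial>measure_pmf p)"
      by (subst nn_integral_distr) (simp_all add: poisson_kernel_def)
    also have "\<dots> = (\<Sum>i. ennreal (pmf p i) * (ennreal (poisson_kernel (f i) y) * indicator A (f i)))"
      by (simp add: nn_integral_measure_pmf nn_integral_count_space_nat)
    also have "\<dots> = (\<Sum>i. ennreal (?g i))"
    proof (intro suminf_cong)
      fix i
      have "pmf p i * poisson_kernel (f i) y = ?c * (q i * f i ^ y)"
        using Z by (simp add: p poisson_kernel_def exp_minus field_simps)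
      then show "ennreal (pmf p i) * (ennreal (poisson_kernel (f i) y) * indicator A (f i)) = ennreal (?g i)"
        by (simp flip: ennreal_mult' split: split_indicator)
    qed
    also have "\<dots> = ennreal (suminf ?g)"
      using nn summable_mult [OF sm', of ?c] by (intro suminf_ennreal2) auto
    finally have "measure ?J (A \<times> {y}) = suminf ?g"
      using nn summable_mult [OF sm', of ?c] by (simp add: measure_def suminf_nonneg)
    also have "\<dots> = ?c * (\<Sum>i. q i * f i ^ y * indicator A (f i))"
      by (rule suminf_mult [OF sm'])
    finally show ?thesis .
  qed
  have "{\<omega> \<in> space ?J. fst \<omega> \<le> t \<and> snd \<omega> = y} = {..t} \<times> {y}"
    "{\<omega> \<in> space ?J. snd \<omega> = y} = UNIV \<times> {y}"
    by (auto simp: space)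
  then show ?thesis
    using J [of "{..t}"] J [of UNIV] Z by (simp add: cond_prob_def)
qed

text \<open>\<open>upper\<close> says that the atoms up to index \<open>m\<close> carry at least
  half of the conditional mass, \<open>lower\<close> that those before \<open>m\<close> carry less
  than half. Hence the conditional cdf is at least 1/2 exactly on \<open>{f m..}\<close>.\<close>

lemma cond_median_poisson_joint:
  fixes f q :: "nat \<Rightarrow> real" and p :: "nat pmf"
  assumes f: "\<And>i. 0 < f i" "mono f" and q: "\<And>i. 0 \<le> q i" "q k \<noteq> 0" and Z: "0 < Z"
    and p: "\<And>i. pmf p i = q i * exp (f i) / Z"
    and sm: "summable (\<lambda>i. q i * f i ^ y)"
    and upper: "0 \<le> (\<Sum>i. cut_sign m i * (q i * f i ^ y))"
    and lower: "0 < m \<Longrightarrow> (\<Sum>i. cut_sign (m - 1) i * (q i * f i ^ y)) < 0"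
  shows "cond_median (poisson_joint (distr (measure_pmf p) borel f)) fst snd y = f m"
proof -
  let ?w = "\<lambda>i. q i * f i ^ y"
  let ?N = "\<lambda>t. \<Sum>i. ?w i * indicator {..t} (f i)"
  have w: "0 \<le> ?w i" for i
    using q f(1) [of i] by simp
  have "0 < q k"
    using q by (metis order_neq_le_trans)
  then have "0 < ?w k"
    using f(1) [of k] by simp
  with sm w have D: "0 < suminf ?w"
    by (rule suminf_pos2)
  have smI: "summable (\<lambda>i. ?w i * indicator {..t} (f i))" for t
    using sm by (rule summable_comparison_test') (use w in \<open>auto split: split_indicator\<close>)
  have diff: "(\<lambda>i. 2 * (?w i * indicator {..t} (f i)) - ?w i) sums (2 * ?N t - suminf ?w)" for t
    by (intro sums_diff sums_mult summable_sums smI sm)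
  have cut: "(\<lambda>i. cut_sign j i * ?w i) sums (\<Sum>i. cut_sign j i * ?w i)" for j
    by (intro summable_sums summable_cut_sign sm w)
  have "1 / 2 \<le> ?N t / suminf ?w \<longleftrightarrow> f m \<le> t" for t
  proof
    assume t: "f m \<le> t"
    have "(\<Sum>i. cut_sign m i * ?w i) \<le> 2 * ?N t - suminf ?w"
    proof (rule sums_le [OF _ cut diff])
      show "cut_sign m i * ?w i \<le> 2 * (?w i * indicator {..t} (f i)) - ?w i" for i
        using w [of i] t monoD [OF f(2), of i m]
        by (cases "i \<le> m") (auto simp: cut_sign_def split: split_indicator)
    qed
    with upper D show "1 / 2 \<le> ?N t / suminf ?w"
      by (simp add: field_simps)
  next
    assume le: "1 / 2 \<le> ?N t / suminf ?w"
    show "f m \<le> t"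
    proof (rule ccontr)
      assume "\<not> f m \<le> t"
      then have less: "i < m" if "f i \<le> t" for i
        using that monoD [OF f(2), of m i] by (meson not_le order_trans)
      show False
      proof (cases "m = 0")
        case True
        with less have "?w i * indicator {..t} (f i) = 0" for i
          by (auto split: split_indicator)
        then have "?N t = 0"
          by (simp only: suminf_zero)
        with le show False
          by simp
      next
        case False
        have "2 * ?N t - suminf ?w \<le> (\<Sum>i. cut_sign (m - 1) i * ?w i)"
        proof (rule sums_le [OF _ diff cut])
          show "2 * (?w i * indicator {..t} (f i)) - ?w i \<le> cut_sign (m - 1) i * ?w i" for i
            using w [of i] less [of i] by (auto simp: cut_sign_def split: split_indicator)
        qed
        with lower False D le show False
          by (simp add: field_simps)
      qed
    qed
  qed
  then have "{t. 1 / 2 \<le> ?N t / suminf ?w} = {f m..}"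
    by auto
  then show ?thesis
    by (simp add: cond_median_def cond_prob_poisson_joint [OF f(1) q(1) Z p sm])
qed

text \<open>Raise \<open>x / t \<le> exp (x / t)\<close> to the power \<open>t\<close>, which gives
  \<open>C = t powr t\<close>. It will turn exponential summability of weights into summability
  against every power.\<close>

lemma powr_le_const_mult_exp:
  fixes t :: real
  assumes "0 \<le> t"
  shows "\<exists>C. \<forall>x>0. x powr t \<le> C * exp x"
proof (cases "t = 0")
  case True
  then show ?thesis
    by (intro exI [of _ 1]) auto
next
  case False
  have "x powr t \<le> t powr t * exp x" if "0 < x" for x
  proof -
    have "x / t \<le> exp (x / t)"
      using exp_ge_add_one_self [of "x / t"] by linarith
    then have "x \<le> t * exp (x / t)"
      using False assms by (simp add: field_simps)
    then have "x powr t \<le> (t * exp (x / t)) powr t"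
      using that assms by (intro powr_mono2) auto
    also have "\<dots> = t powr t * exp x"
      using False assms by (simp add: powr_mult exp_powr_real)
    finally show ?thesis .
  qed
  then show ?thesis
    by blast
qed

theorem theorem1:
  fixes f :: "nat \<Rightarrow> real" and c0 :: enat
  assumes f_pos: "\<And>i. 0 < f i"
    and f_incr: "\<And>i. 1 \<le> i \<Longrightarrow> enat i \<le> c0 \<Longrightarrow> f (i - 1) < f i"
    and f_const: "\<And>i. c0 \<le> enat i \<Longrightarrow> f (i + 1) = f (the_enat c0)"
    and summable: "\<exists>\<kappa>::real. 1 \<le> \<kappa> \<and>
      (\<lambda>i. (f (nat \<lfloor>real i / \<kappa>\<rfloor>) / f i) powr (real i / \<kappa>) * exp (f i))
        summable_on {i. 1 \<le> i \<and> enat i \<le> c0}"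
  shows "\<exists>P :: real measure. prob_space P \<and> sets P = sets borel \<and>
    supported_on P {w. \<exists>i::nat. 1 \<le> i \<and> w = f (i - 1)} \<and>
    (\<forall>y. cond_median (poisson_joint P) fst snd y = f y)"
proof -
  obtain \<kappa> :: real where \<kappa>: "1 \<le> \<kappa>" and
    h_on: "(\<lambda>i. (f (nat \<lfloor>real i / \<kappa>\<rfloor>) / f i) powr (real i / \<kappa>) * exp (f i))
      summable_on {i. 1 \<le> i \<and> enat i \<le> c0}"
    using summable by blast
  have f_eq: "f i = f (the_enat c0)" if "c0 \<le> enat i" for i
  proof (cases "c0 = enat i")
    case False
    with that obtain j where "i = j + 1" "c0 \<le> enat j"
      by (cases i; cases c0) auto
    then show ?thesis
      using f_const [of j] by simp
  qed simp
  have step: "f i < f (Suc i)" if "enat i < c0" for i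
    using f_incr [of "Suc i"] that by (simp add: Suc_ile_eq)
  have "mono f"
  proof (rule incseq_SucI)
    show "f i \<le> f (Suc i)" for i
      using step [of i] f_eq [of i] f_const [of i] by (cases "enat i < c0") auto
  qed

  \<comment> \<open>Exponents for the cuts\<close>
  \<comment> \<open>Ceiling minus one, not the floor, keeps \<open>s y\<close> strictly below
    \<open>y + 1\<close> even if \<open>\<kappa> * (y + 1)\<close> is an integer;
    \<open>\<kappa> \<ge> 1\<close> keeps it at or above \<open>y\<close>.\<close>
  define s where "s y = real_of_int (\<lceil>\<kappa> * (real y + 1)\<rceil> - 1) / \<kappa>" for y :: nat
  have s_lower: "real y \<le> s y" for y
  proof -
    have "real y * \<kappa> \<le> \<kappa> * (real y + 1) - 1"
      using \<kappa> by (simp add: algebra_simps)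
    also have "\<dots> \<le> real_of_int (\<lceil>\<kappa> * (real y + 1)\<rceil> - 1)"
      by simp
    finally show ?thesis
      using \<kappa> by (simp add: s_def field_simps)
  qed
  have s_upper: "s y < real y + 1" for y
  proof -
    have "real_of_int (\<lceil>\<kappa> * (real y + 1)\<rceil> - 1) < \<kappa> * (real y + 1)"
      by linarith
    then show ?thesis
      using \<kappa> by (simp add: s_def field_simps)
  qed
  have "mono s"
    by (rule incseq_SucI) (use s_lower [of "Suc _"] s_upper in \<open>smt (verit) of_nat_Suc\<close>)
  have s_nonneg: "0 \<le> s y" for y
    using s_lower [of y] by linarith
  \<comment> \<open>The integer \<open>i\<close> lies strictly below \<open>\<kappa>\<close> times
    the floor plus one, hence is at most the numerator of the exponent.\<close>
  have s_floor: "real i / \<kappa> \<le> s (nat \<lfloor>real i / \<kappa>\<rfloor>)" for i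
  proof -
    have "real i / \<kappa> < real (nat \<lfloor>real i / \<kappa>\<rfloor>) + 1"
      by linarith
    then have "real_of_int (int i) < \<kappa> * (real (nat \<lfloor>real i / \<kappa>\<rfloor>) + 1)"
      using \<kappa> by (simp add: field_simps)
    then have "int i \<le> \<lceil>\<kappa> * (real (nat \<lfloor>real i / \<kappa>\<rfloor>) + 1)\<rceil> - 1"
      by (simp add: less_ceiling_iff flip: zless_imp_add1_zle)
    then have "real i \<le> real_of_int (\<lceil>\<kappa> * (real (nat \<lfloor>real i / \<kappa>\<rfloor>) + 1)\<rceil> - 1)"
      by linarith
    then show ?thesis
      unfolding s_def using \<kappa> by (intro divide_right_mono) auto
  qed

  \<comment> \<open>Balanced weights for the atoms \<open>f i\<close>\<close>
  have summable_powr: "summable (\<lambda>i. g i * f i powr t)"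
    if g: "summable (\<lambda>i. g i * exp (f i))" "\<And>i. 0 \<le> g i" and t: "0 \<le> t"
    for g :: "nat \<Rightarrow> real" and t
  proof -
    obtain C where C: "\<And>x. 0 < x \<Longrightarrow> x powr t \<le> C * exp x"
      using powr_le_const_mult_exp [OF t] by blast
    show ?thesis
    proof (rule summable_comparison_test' [OF summable_mult [OF g(1), of C]])
      show "norm (g i * f i powr t) \<le> C * (g i * exp (f i))" for i
        using mult_left_mono [OF C [OF f_pos] g(2) [of i], of i] g(2) [of i] by (simp add: mult_ac)
    qed
  qed

  txt \<open>For infinite \<^term>\<open>c0\<close>, balance at the cut \<^term>\<open>nat \<lfloor>real i / \<kappa>\<rfloor>\<close> bounds the i-th weight by
    \<^term>\<open>h i\<close>; this is why the exponent \<^term>\<open>s y\<close> is the largest \<^term>\<open>real i / \<kappa>\<close> below \<^term>\<open>y + 1\<close>.\<close>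
  have "\<exists>q. (\<forall>i. 0 \<le> q i \<and> (c0 < enat i \<longrightarrow> q i = 0)) \<and> q sums 1 \<and>
      summable (\<lambda>i. q i * exp (f i)) \<and>
      (\<forall>y. enat y < c0 \<longrightarrow> (\<lambda>i. cut_sign y i * (q i * f i powr s y)) sums 0)"
  proof (cases c0)
    case (enat n)
    obtain q where q: "\<And>i. 0 \<le> q i" "\<And>i. n < i \<Longrightarrow> q i = 0" "q sums 1"
      "\<And>y. y < n \<Longrightarrow> (\<lambda>i. cut_sign y i * (q i * f i powr s y)) sums 0"
      using finite_balanced_weights [OF f_pos \<open>mono f\<close> \<open>mono s\<close>] by blast
    have "summable (\<lambda>i. q i * exp (f i))"
      using q(2) by (intro summable_finite [of "{..n}"]) auto
    with q enat show ?thesis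
      by auto
  next
    case infinity
    define h where "h i = (f (nat \<lfloor>real i / \<kappa>\<rfloor>) / f i) powr (real i / \<kappa>)" for i
    have h: "h 0 = 1" "0 \<le> h i" for i
      using f_pos [of 0] by (simp_all add: h_def)
    have "(\<lambda>i. h i * exp (f i)) summable_on insert 0 {i. 1 \<le> i}"
      using h_on infinity by (simp add: h_def summable_on_insert_iff)
    also have "insert 0 {i. 1 \<le> i} = (UNIV :: nat set)"
      by auto
    finally have h_sm: "summable (\<lambda>i. h i * exp (f i))"
      by (rule summable_on_imp_summable)
    \<comment> \<open>For \<open>\<kappa> = 1\<close> the summands would be
      \<open>exp (f i) \<ge> 1\<close>. Excluding this makes the floor of
      \<open>i / \<kappa>\<close> strictly smaller than \<open>i\<close>, so that it is a cut below
      \<open>i\<close>.\<close>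
    have "\<kappa> \<noteq> 1"
    proof
      assume "\<kappa> = 1"
      then have "h i = 1" for i
        using f_pos [of i] by (simp add: h_def)
      then have "(\<lambda>i. exp (f i)) \<longlonglongrightarrow> 0"
        using summable_LIMSEQ_zero [OF h_sm] by simp
      then have "1 \<le> (0 :: real)"
        by (rule LIMSEQ_le_const) (use f_pos in \<open>auto simp: less_imp_le\<close>)
      then show False
        by simp
    qed
    have cut: "\<exists>y<i. (f y / f i) powr s y \<le> h i" if "0 < i" for i
    proof (intro exI conjI)
      let ?y = "nat \<lfloor>real i / \<kappa>\<rfloor>"
      have "real i / \<kappa> < real i"
        using \<kappa> \<open>\<kappa> \<noteq> 1\<close> that by (simp add: field_simps)
      moreover have "real ?y \<le> real i / \<kappa>"
        using \<kappa> by (intro of_nat_floor) simp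
      ultimately show "?y < i"
        by linarith
      \<comment> \<open>For a base of at most 1, the larger exponent \<open>s ?y\<close> gives the
        smaller power.\<close>
      then have "f ?y / f i \<le> 1"
        using monoD [OF \<open>mono f\<close>, of ?y i] f_pos [of i] by simp
      then show "(f ?y / f i) powr s ?y \<le> h i"
        unfolding h_def using f_pos s_floor by (intro powr_mono') (auto intro: less_imp_le)
    qed
    have "summable h"
    proof (rule summable_comparison_test' [OF h_sm])
      show "norm (h i) \<le> h i * exp (f i)" for i
        using mult_left_mono [of 1 "exp (f i)" "h i"] h(2) [of i] f_pos [of i] by simp
    qed
    then obtain q where q: "\<And>i. 0 \<le> q i" "\<And>i. q i \<le> h i" "q sums 1"
      "\<And>y. (\<lambda>i. cut_sign y i * (q i * f i powr s y)) sums 0"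
      using infinite_balanced_weights
        [OF f_pos \<open>mono f\<close> \<open>mono s\<close> s_nonneg _ cut _ summable_powr [OF h_sm h(2) s_nonneg]] h(1)
      by auto
    have "summable (\<lambda>i. q i * exp (f i))"
      using h_sm by (rule summable_comparison_test') (use q in \<open>auto intro: mult_right_mono\<close>)
    with q infinity show ?thesis
      by auto
  qed
  then obtain q where q: "\<And>i. 0 \<le> q i" "\<And>i. c0 < enat i \<Longrightarrow> q i = 0" "q sums 1"
      "summable (\<lambda>i. q i * exp (f i))"
      "\<And>y. enat y < c0 \<Longrightarrow> (\<lambda>i. cut_sign y i * (q i * f i powr s y)) sums 0"
    by blast

  \<comment> \<open>The prior and its conditional medians\<close>
  obtain k where k: "q k \<noteq> 0"
    using q(3) by (metis sums_0 sums_unique2 zero_neq_one)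
  define Z where "Z = (\<Sum>i. q i * exp (f i))"
  have "0 < q k"
    using q(1) k by (metis order_neq_le_trans)
  then have Z: "0 < Z"
    unfolding Z_def using q(4) by (intro suminf_pos2 [of _ k]) (simp_all add: q(1))
  \<comment> \<open>Tilting by \<open>exp (f i)\<close> anticipates the factor
    \<open>exp (- f i)\<close> of the kernel, so that \<open>q i * f i ^ y\<close> is left as
    conditional weight.\<close>
  define p where "p = embed_pmf (\<lambda>i. q i * exp (f i) / Z)"
  have p: "pmf p i = q i * exp (f i) / Z" for i
    unfolding p_def
  proof (rule pmf_embed_pmf)
    show "0 \<le> q i * exp (f i) / Z" for i
      using q(1) Z by simp
    have "(\<integral>\<^sup>+i. ennreal (q i * exp (f i) / Z) \<partial>count_space UNIV) =
        ennreal (\<Sum>i. q i * exp (f i) / Z)"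
      unfolding nn_integral_count_space_nat
      using q(1,4) Z by (intro suminf_ennreal2) (auto intro: summable_divide)
    also have "(\<Sum>i. q i * exp (f i) / Z) = 1"
      using q(4) Z by (simp add: suminf_divide flip: Z_def)
    finally show "(\<integral>\<^sup>+i. ennreal (q i * exp (f i) / Z) \<partial>count_space UNIV) = 1"
      by simp
  qed
  let ?P = "distr (measure_pmf p) borel f"
  have range: "{w. \<exists>i::nat. 1 \<le> i \<and> w = f (i - 1)} = range f"
  proof (intro equalityI subsetI)
    fix w assume "w \<in> range f"
    then obtain i where "w = f (Suc i - 1)"
      by auto
    then show "w \<in> {w. \<exists>i::nat. 1 \<le> i \<and> w = f (i - 1)}"
      by (intro CollectI exI [of _ "Suc i"]) auto
  qed auto
  have meas: "range f \<in> sets borel"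
    by (rule sets.countable) auto
  have "measure ?P (range f) = measure (measure_pmf p) (f -` range f \<inter> space (measure_pmf p))"
    by (rule measure_distr) (simp_all add: meas)
  also have "f -` range f \<inter> space (measure_pmf p) = space (measure_pmf p)"
    by auto
  also have "measure (measure_pmf p) (space (measure_pmf p)) = 1"
    by (rule measure_pmf.prob_space)
  finally have "supported_on ?P (range f)"
    using meas by (simp only: supported_on_def sets_distr)
  moreover have "cond_median (poisson_joint ?P) fst snd y = f y" for y
  proof -
    \<comment> \<open>\<open>m\<close> is the minimum of \<open>y\<close> and \<open>c0\<close>;
      past \<open>c0\<close> the value of \<open>f\<close> stays at \<open>f c0\<close>, and no
      index beyond \<open>c0\<close> carries weight.\<close>
    define m where "m = (if enat y \<le> c0 then y else the_enat c0)"
    have m: "m \<le> y \<and> enat m \<le> c0 \<and> f y = f m \<and> (enat m < c0 \<longrightarrow> m = y)"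
    proof (cases "enat y \<le> c0")
      case True
      then show ?thesis
        by (simp add: m_def)
    next
      case False
      then obtain n where "c0 = enat n" "n < y"
        by (cases c0) auto
      with f_eq [of y] show ?thesis
        by (simp add: m_def)
    qed
    have pow: "f i powr real y = f i ^ y" for i
      using f_pos [of i] by (simp add: powr_realpow)
    have sm: "summable (\<lambda>i. q i * f i powr real y)"
      by (intro summable_powr q) simp
    have "cond_median (poisson_joint ?P) fst snd y = f m"
    proof (rule cond_median_poisson_joint [OF f_pos \<open>mono f\<close> q(1) k Z p])
      show "summable (\<lambda>i. q i * f i ^ y)"
        using sm by (simp add: pow)
      show "0 \<le> (\<Sum>i. cut_sign m i * (q i * f i ^ y))"
      \<comment> \<open>If \<open>m < c0\<close>, then \<open>m = y\<close>, and this cut is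
        balanced at \<open>s y \<ge> y\<close>. If \<open>m = c0\<close>, no weight lies above the
        cut.\<close>
      proof (cases "enat m < c0")
        case True
        have "0 \<le> (\<Sum>i. cut_sign m i * (q i * f i powr real y))"
          using m s_lower [of y] True
          by (intro cut_sum_nonneg [OF f_pos \<open>mono f\<close> q(1) sm _ q(5)]) auto
        then show ?thesis
          by (simp add: pow)
      next
        case False
        then have "c0 = enat m"
          using m by simp
        then have "0 \<le> cut_sign m i * (q i * f i ^ y)" for i
          using q(1,2) [of i] f_pos [of i] by (cases "i \<le> m") (simp_all add: cut_sign_def)
        moreover have "summable (\<lambda>i. cut_sign m i * (q i * f i ^ y))"
          using sm q(1) f_pos by (intro summable_cut_sign) (simp_all add: pow less_imp_le)
        ultimately show ?thesis
          by (intro suminf_nonneg)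
      qed
      show "(\<Sum>i. cut_sign (m - 1) i * (q i * f i ^ y)) < 0" if "0 < m"
      proof -
        have "enat (m - 1) < enat m"
          using that by simp
        then have lt: "enat (m - 1) < c0"
          using conjunct1 [OF conjunct2 [OF m]] by (rule less_le_trans)
        \<comment> \<open>The cut \<open>m - 1\<close> is balanced at an exponent below
          \<open>m \<le> y\<close>; this strict inequality makes the sum at exponent
          \<open>y\<close> strictly negative.\<close>
        have "s (m - 1) < real y"
          using s_upper [of "m - 1"] that m by (simp add: of_nat_diff)
        then have "(\<Sum>i. cut_sign (m - 1) i * (q i * f i powr real y)) < 0"
          by (intro cut_sum_neg [OF f_pos \<open>mono f\<close> step q(1) k sm _ q(5)] lt)
        then show ?thesis
          by (simp add: pow)
      qed
    qed
    with m show ?thesis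
      by simp
  qed
  moreover have "prob_space ?P"
    by (rule measure_pmf.prob_space_distr) simp
  ultimately show ?thesis
    unfolding range by (intro exI [of _ ?P]) simp
qed

end
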